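(* Let $y$, $\alpha$, $K$ be real numbers with $y>0$, $0\leq\alpha<2\pi$, and $0<K<1$. Let $P$ be the set of prime numbers, and let $$P^+=\{p\in P\mid \cos(y\ln p+\alpha)>K\},\qquad P^-=\{p\in P\mid \cos(y\ln p+\alpha)<-K\}.$$ Then $$\sum_{p\in P^+}\frac{1}{p}=\infty\quad\text{and}\quad \sum_{p\in P^-}\frac{1}{p}=\infty.$$
   Context: $\ln$ denotes the natural logarithm. A sum over a set of primes of reciprocals being $\infty$ means that the series of positive terms diverges. *)

theory Defs
  imports "HOL-Analysis.Analysis" "HOL-Computational_Algebra.Primes"
begin

definition P_plus :: "real \<Rightarrow> real \<Rightarrow> real \<Rightarrow> nat set" where
  "P_plus y \<alpha> K = {p. prime p \<and> cos (y * ln (real p) + \<alpha>) > K}"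

definition P_minus :: "real \<Rightarrow> real \<Rightarrow> real \<Rightarrow> nat set" where
  "P_minus y \<alpha> K = {p. prime p \<and> cos (y * ln (real p) + \<alpha>) < - K}"

end

theory Submission
  imports Defs "HOL-Complex_Analysis.Complex_Analysis" "HOL-Number_Theory.Prime_Powers"
begin

text \<open>
  The angles \<open>y ln p\<close>, taken modulo \<open>2\<pi>\<close>, are equidistributed when a prime \<open>p\<close> carries the mass
  \<open>\<delta> ln p / p\<^bsup>1+\<delta>\<^esup>\<close> and \<open>\<delta>\<close> tends to 0 from above, so every arc of the circle receives a positive
  share of a total mass that tends to 1. If the reciprocals of the primes in some arc had a finite
  sum, that arc would receive no mass in the limit: since \<open>x \<le> exp x\<close> with \<open>x = \<delta> ln p\<close>, the mass
  of \<open>p\<close> is at most \<open>1/p\<close> for every \<open>\<delta>\<close>, and it tends to 0 for fixed \<open>p\<close>, so dominated convergence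
  applies (\<open>mangoldt_weight_sparse_limit\<close>). That is the contradiction.

  It is convenient to let all prime powers carry mass, by means of the von Mangoldt function
  \<open>\<Lambda>\<close>; the proper powers contribute nothing in the limit. With
  \<open>F(s) = \<Sum>n. \<Lambda>(n) n\<^bsup>-s\<^esup> = -\<zeta>'(s)/\<zeta>(s)\<close>, the Fourier coefficient of the mass distribution at
  frequency \<open>t\<close> is \<open>\<delta> F(1 + \<delta> - it)\<close>. The function \<open>(s - 1) \<zeta>(s)\<close> is holomorphic for \<open>Re s > 0\<close> and
  equals 1 at \<open>s = 1\<close>, so this coefficient tends to 1 if \<open>t = 0\<close> and to \<open>-m(t)\<close> otherwise, where
  \<open>m(t)\<close> is the order of the zero of \<open>\<zeta>\<close> at \<open>1 - it\<close> (\<open>mangoldt_ser_limit\<close>). The masses being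
  nonnegative, \<open>3 + 4 cos x + cos 2x \<ge> 0\<close> yields \<open>3 - 4 m(t) - m(2t) \<ge> 0\<close>, which forces
  \<open>m(t) = 0\<close> (\<open>mangoldt_weight_cis_limit\<close>). Thus all nonzero frequencies die out, and the average of a
  trigonometric polynomial tends to its constant coefficient.

  One explicit polynomial suffices as a test function for the arc \<open>cos x > K\<close>: the difference
  \<open>((1 + cos x)/2)\<^bsup>N\<^esup> - ((1 + K)/2)\<^bsup>N\<^esup>\<close> is at most 0 outside the arc and at most 1 inside, while its
  constant coefficient is the central binomial coefficient of \<open>2N\<close> over \<open>4\<^bsup>N\<^esup>\<close> minus an
  exponentially small number, which is positive for large \<open>N\<close>. The arc \<open>cos x < -K\<close> is the
  same arc after a shift of \<open>\<alpha>\<close> by \<open>\<pi>\<close>.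
\<close>

section \<open>Continuation of the zeta function to the right half-plane\<close>

lemma norm_of_nat_powr:
  "norm (of_nat n powr s :: complex) = real n powr Re s"
  by (subst norm_powr_real_powr) auto

text \<open>
  This is \<open>(s - 1)\<close> times the difference between \<open>(n+1)\<^bsup>-s\<^esup>\<close> and the integral of \<open>x\<^bsup>-s\<^esup>\<close> over
  \<open>[n+1, n+2]\<close>. Multiplying by \<open>s - 1\<close> removes the pole of the zeta function, so no point has to be excluded.
\<close>
definition zeta_term :: "nat \<Rightarrow> complex \<Rightarrow> complex" where
  "zeta_term n s = (s - 1) * of_nat (Suc n) powr (-s)
     - of_nat (Suc n) powr (1 - s) + of_nat (Suc (Suc n)) powr (1 - s)"

lemma norm_powr_diff_le:
  fixes s :: complex and x :: real
  assumes "0 < a" "a \<le> x" "0 < Re s"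
  shows "norm (of_real x powr (-s) - of_real a powr (-s)) \<le> norm s * a powr (-Re s - 1) * (x - a)"
proof -
  have "norm (of_real x powr (-s) - of_real a powr (-s) :: complex)
      \<le> (norm s * a powr (-Re s - 1)) * norm (of_real x - of_real a :: complex)"
  proof (rule field_differentiable_bound)
    show "convex (of_real ` {a..x} :: complex set)"
      using assms closed_segment_of_real[of a x] convex_closed_segment
      by (metis closed_segment_eq_real_ivl1)
    fix z :: complex assume "z \<in> of_real ` {a..x}"
    then obtain u where u: "z = of_real u" "a \<le> u" "u \<le> x" by auto
    show "((\<lambda>z. z powr (-s)) has_field_derivative (-s) * z powr (-s - 1)) (at z within of_real ` {a..x})"
      using u assms by (intro has_field_derivative_at_within[OF has_field_derivative_powr]) auto
    have "norm (z powr (-s - 1)) = u powr (-Re s - 1)"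
      using u assms by (subst norm_powr_real_powr) auto
    also have "\<dots> \<le> a powr (-Re s - 1)"
      using u assms by (intro powr_mono2') auto
    finally show "norm (- s * z powr (- s - 1)) \<le> norm s * a powr (-Re s - 1)"
      by (simp add: norm_mult mult_left_mono)
  qed (use assms in auto)
  thus ?thesis using assms by (simp flip: of_real_diff)
qed

text \<open>
  The term is the increment over \<open>[n+1, n+2]\<close> of an antiderivative of
  \<open>(s - 1) ((n+1)\<^bsup>-s\<^esup> - x\<^bsup>-s\<^esup>)\<close>. The gain of one power of \<open>n\<close> over the individual summands is
  what makes the series converge beyond the line \<open>Re s = 1\<close>.
\<close>
lemma norm_zeta_term_le:
  assumes "0 < Re s"
  shows "norm (zeta_term n s) \<le> norm (s - 1) * norm s * real (Suc n) powr (-Re s - 1)"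
proof -
  define a where "a = real (Suc n)"
  have a: "0 < a" by (simp add: a_def)
  define I where "I = (of_real ` {a..a+1} :: complex set)"
  define h where "h = (\<lambda>z. (s - 1) * (z - of_real a) * of_real a powr (-s) + z powr (1 - s))"
  have "norm (h (of_real (a + 1)) - h (of_real a))
      \<le> (norm (s - 1) * norm s * a powr (-Re s - 1)) * norm (of_real (a + 1) - of_real a :: complex)"
  proof (rule field_differentiable_bound)
    show "convex I"
      using closed_segment_of_real[of a "a + 1"] convex_closed_segment unfolding I_def
      by (metis closed_segment_eq_real_ivl1 le_add_same_cancel1 zero_le_one)
    fix z :: complex assume "z \<in> I"
    then obtain u where u: "z = of_real u" "a \<le> u" "u \<le> a + 1" by (auto simp: I_def)
    show "(h has_field_derivative (s - 1) * (of_real a powr (-s) - z powr (-s))) (at z within I)"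
      unfolding h_def using u a
      by (auto intro!: derivative_eq_intros has_field_derivative_at_within[OF has_field_derivative_powr]
               simp: algebra_simps)
    have "norm (of_real a powr (-s) - z powr (-s)) \<le> norm s * a powr (-Re s - 1) * (u - a)"
      using norm_powr_diff_le[of a u s] u a assms by (simp add: norm_minus_commute)
    also have "\<dots> \<le> norm s * a powr (-Re s - 1) * 1"
      using u by (intro mult_left_mono) auto
    finally show "norm ((s - 1) * (of_real a powr (-s) - z powr (-s)))
        \<le> norm (s - 1) * norm s * a powr (-Re s - 1)"
      by (simp add: norm_mult mult_left_mono mult.assoc)
  next
    show "of_real (a + 1) \<in> I" "of_real a \<in> I"
      unfolding I_def by (intro imageI; simp)+
  qed
  also have "h (of_real (a + 1)) - h (of_real a) = zeta_term n s"
    by (simp add: h_def zeta_term_def a_def algebra_simps)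
  finally show ?thesis by (simp add: a_def)
qed

text \<open>
  The function \<open>(s - 1) \<zeta>(s)\<close>, continued to \<open>Re s > 0\<close>; the leading 1 compensates the
  boundary term \<open>-1\<^bsup>1-s\<^esup>\<close> left over by the telescoping part of the series.
\<close>
definition zeta_num :: "complex \<Rightarrow> complex" where
  "zeta_num s = 1 + (\<Sum>n. zeta_term n s)"

lemma zeta_term_series:
  "\<exists>g. \<forall>s\<in>{s. 0 < Re s}. (\<lambda>n. zeta_term n s) sums g s \<and> g field_differentiable (at s)"
proof -
  have "\<exists>g g'. \<forall>s\<in>{s. 0 < Re s}. (\<lambda>n. zeta_term n s) sums g s \<and>
      (\<lambda>n. deriv (zeta_term n) s) sums g' s \<and> (g has_field_derivative g' s) (at s)"
  proof (rule series_and_derivative_comparison_local)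
    show "open {s. 0 < Re s}" by (simp add: open_halfspace_Re_gt)
    fix n s assume "s \<in> {s. 0 < Re s}"
    have "zeta_term n holomorphic_on UNIV"
      unfolding zeta_term_def[abs_def] by (intro holomorphic_intros)
    then show "(zeta_term n has_field_derivative deriv (zeta_term n) s) (at s)"
      by (rule holomorphic_derivI) auto
  next
    fix s assume s: "s \<in> {s. 0 < Re s}"
    define d where "d = Re s / 2"
    define C where "C = (norm s + d + 1)\<^sup>2"
    have d: "d > 0" using s by (simp add: d_def)
    have bd: "norm (zeta_term n z) \<le> C * real (Suc n) powr (-d - 1)" if z: "z \<in> ball s d" for n z
    proof -
      have dz: "norm (z - s) < d" using z by (simp add: dist_norm norm_minus_commute)
      hence "Re (s - z) < d" using complex_Re_le_cmod[of "s - z"] by (simp add: norm_minus_commute)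
      hence re: "d < Re z" by (simp add: d_def)
      have 1: "norm z \<le> norm s + d + 1" "norm (z - 1) \<le> norm s + d + 1"
        using norm_triangle_ineq[of s "z - s"] norm_triangle_ineq4[of z 1] dz by auto
      have "norm (zeta_term n z) \<le> norm (z - 1) * norm z * real (Suc n) powr (-Re z - 1)"
        using re d by (intro norm_zeta_term_le) auto
      also have "\<dots> \<le> ((norm s + d + 1) * (norm s + d + 1)) * real (Suc n) powr (-d - 1)"
        using 1 re d by (intro mult_mono powr_mono) auto
      finally show ?thesis by (simp add: C_def power2_eq_square)
    qed
    have "summable (\<lambda>n. real (Suc n) powr (-d - 1))"
      using d summable_real_powr_iff[of "-d - 1"] by (subst summable_Suc_iff) auto
    hence "summable (\<lambda>n. C * real (Suc n) powr (-d - 1))" by (rule summable_mult)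
    thus "\<exists>d h. 0 < d \<and> summable h \<and>
        (\<forall>\<^sub>F n in sequentially. \<forall>y\<in>ball s d \<inter> {s. 0 < Re s}. norm (zeta_term n y) \<le> h n)"
      using d bd by (intro exI[of _ d] exI[of _ "\<lambda>n. C * real (Suc n) powr (-d - 1)"]) auto
  qed
  thus ?thesis unfolding field_differentiable_def by meson
qed

lemma zeta_num_holomorphic: "zeta_num holomorphic_on {s. 0 < Re s}"
proof -
  obtain g where g: "\<And>s. 0 < Re s \<Longrightarrow> (\<lambda>n. zeta_term n s) sums g s"
      "\<And>s. 0 < Re s \<Longrightarrow> g field_differentiable (at s)"
    using zeta_term_series by auto
  have "(\<lambda>s. 1 + g s) holomorphic_on {s. 0 < Re s}"
    by (intro holomorphic_intros) (auto simp: holomorphic_on_def g intro: field_differentiable_at_within)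
  thus ?thesis
    by (rule holomorphic_transform) (auto simp: zeta_num_def dest: g(1) sums_unique)
qed

lemma zeta_num_1: "zeta_num 1 = 1"
  by (simp add: zeta_num_def zeta_term_def del: of_nat_Suc)

section \<open>The Dirichlet series of the zeta function and its derivative\<close>

lemma zeta_deriv_series:
  "\<exists>g g'. \<forall>s\<in>{s. 1 < Re s}. (\<lambda>n. of_nat n powr (-s)) sums g s \<and>
     (\<lambda>n. - of_real (ln (real n)) * of_nat n powr (-s)) sums g' s \<and>
     (g has_field_derivative g' s) (at s)"
proof (rule series_and_derivative_comparison_local)
  show "open {s. 1 < Re s}" by (simp add: open_halfspace_Re_gt)
  fix n :: nat and s :: complex
  show "((\<lambda>s. of_nat n powr (-s)) has_field_derivative
      - of_real (ln (real n)) * of_nat n powr (-s)) (at s)"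
  proof (cases "n = 0")
    case False
    have "((\<lambda>s. of_nat n powr (-s)) has_field_derivative (Ln (of_nat n) * of_nat n powr (-s)) * (-1)) (at s)"
      using False by (intro DERIV_chain2[OF has_field_derivative_powr_right] derivative_intros) auto
    thus ?thesis using False by simp
  qed auto
next
  fix s assume s: "s \<in> {s. 1 < Re s}"
  define d where "d = (Re s - 1) / 2"
  have d: "d > 0" using s by (simp add: d_def)
  have bd: "norm (of_nat n powr (-z) :: complex) \<le> real n powr (-d - 1)" if z: "z \<in> ball s d" for n z
  proof (cases "n = 0")
    case False
    have "norm (s - z) < d" using z by (simp add: dist_norm)
    hence "Re (s - z) < d" using complex_Re_le_cmod[of "s - z"] by simp
    hence re: "1 + d < Re z" by (simp add: d_def field_simps)
    with False show ?thesis by (auto simp: norm_of_nat_powr intro!: powr_mono)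
  qed auto
  have "summable (\<lambda>n. real n powr (-d - 1))"
    using d summable_real_powr_iff[of "-d - 1"] by auto
  thus "\<exists>d h. 0 < d \<and> summable h \<and>
      (\<forall>\<^sub>F n in sequentially. \<forall>y\<in>ball s d \<inter> {s. 1 < Re s}. norm (of_nat n powr (-y) :: complex) \<le> h n)"
    using d bd by (intro exI[of _ d] exI[of _ "\<lambda>n. real n powr (-d - 1)"]) auto
qed

definition zeta_ser :: "complex \<Rightarrow> complex" where
  "zeta_ser s = (\<Sum>n. of_nat n powr (-s))"

lemma zeta_ser_sums: "1 < Re s \<Longrightarrow> (\<lambda>n. of_nat n powr (-s)) sums zeta_ser s"
  using zeta_deriv_series unfolding zeta_ser_def by (metis mem_Collect_eq sums_iff)

lemma zeta_ser_has_deriv: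
  assumes "1 < Re s"
  shows "(\<lambda>n. of_real (ln (real n)) * of_nat n powr (-s)) sums (- deriv zeta_ser s)"
    and "(zeta_ser has_field_derivative deriv zeta_ser s) (at s)"
proof -
  obtain g g' where g: "\<And>s. 1 < Re s \<Longrightarrow> (\<lambda>n. of_nat n powr (-s)) sums g s"
     "\<And>s. 1 < Re s \<Longrightarrow> (\<lambda>n. - of_real (ln (real n)) * of_nat n powr (-s)) sums g' s"
     "\<And>s. 1 < Re s \<Longrightarrow> (g has_field_derivative g' s) (at s)"
    using zeta_deriv_series by auto
  have eq: "g z = zeta_ser z" if "1 < Re z" for z
    using g(1)[OF that] zeta_ser_sums[OF that] sums_unique2 by blast
  have D: "(zeta_ser has_field_derivative g' s) (at s)"
    by (rule has_field_derivative_transform_within_open[OF g(3)[OF assms], of "{s. 1 < Re s}"])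
       (use assms eq in \<open>auto simp: open_halfspace_Re_gt\<close>)
  hence "deriv zeta_ser s = g' s" by (rule DERIV_imp_deriv)
  with D sums_minus[OF g(2)[OF assms]]
  show "(zeta_ser has_field_derivative deriv zeta_ser s) (at s)"
    "(\<lambda>n. of_real (ln (real n)) * of_nat n powr (-s)) sums (- deriv zeta_ser s)" by simp_all
qed

text \<open>
  For \<open>Re s > 1\<close> the powers \<open>(n+1)\<^bsup>1-s\<^esup>\<close> tend to 0, so the telescoping part of the series sums to \<open>-1\<close>.
\<close>
lemma zeta_num_eq:
  assumes "1 < Re s"
  shows "zeta_num s = (s - 1) * zeta_ser s"
proof -
  have "(\<lambda>n. of_nat (Suc n) powr (-s)) sums zeta_ser s"
    using zeta_ser_sums[OF assms] by (subst sums_Suc_iff) simp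
  hence 1: "(\<lambda>n. (s - 1) * of_nat (Suc n) powr (-s)) sums ((s - 1) * zeta_ser s)"
    by (rule sums_mult)
  have "(\<lambda>n. norm (of_nat (Suc n) powr (1 - s) :: complex)) \<longlonglongrightarrow> 0"
    unfolding norm_of_nat_powr
    by (rule LIMSEQ_Suc, rule tendsto_neg_powr) (use assms in \<open>auto simp: filterlim_real_sequentially\<close>)
  hence "(\<lambda>n. of_nat (Suc n) powr (1 - s) :: complex) \<longlonglongrightarrow> 0" by (simp only: tendsto_norm_zero_iff)
  hence 2: "(\<lambda>n. of_nat (Suc (Suc n)) powr (1 - s) - of_nat (Suc n) powr (1 - s) :: complex) sums (0 - of_nat (Suc 0) powr (1 - s))"
    by (rule telescope_sums)
  have "(\<lambda>n. zeta_term n s) sums ((s - 1) * zeta_ser s + (0 - of_nat (Suc 0) powr (1 - s)))"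
    using sums_add[OF 1 2] by (simp add: zeta_term_def algebra_simps)
  thus ?thesis by (simp add: zeta_num_def sums_iff)
qed

section \<open>The logarithmic derivative of the zeta function\<close>

definition mangoldt_ser :: "complex \<Rightarrow> complex" where
  "mangoldt_ser s = (\<Sum>\<^sub>\<infinity>n. mangoldt n * of_nat n powr (-s))"

lemma summable_zeta:
  assumes "1 < \<sigma>"
  shows "(\<lambda>n. real n powr (-\<sigma>)) summable_on UNIV"
  using assms summable_real_powr_iff[of "-\<sigma>"]
  by (intro summable_nonneg_imp_summable_on) auto

lemma summable_mangoldt:
  assumes "1 < \<sigma>"
  shows "(\<lambda>n. mangoldt n * real n powr (-\<sigma>)) summable_on UNIV"
proof -
  have "(\<lambda>n. Re (of_real (ln (real n)) * of_nat n powr (-of_real \<sigma>))) sums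
     Re (- deriv zeta_ser (of_real \<sigma>))"
    using assms by (intro sums_Re zeta_ser_has_deriv) auto
  moreover have "of_nat n powr (-of_real \<sigma>) = complex_of_real (real n powr (-\<sigma>))" for n
    by (simp flip: powr_of_real)
  ultimately have "summable (\<lambda>n. ln (real n) * real n powr (-\<sigma>))"
    by (simp add: sums_iff)
  moreover have "ln (real n) \<ge> 0" for n by (cases "n = 0") auto
  ultimately have "(\<lambda>n. ln (real n) * real n powr (-\<sigma>)) summable_on UNIV"
    by (intro summable_nonneg_imp_summable_on) auto
  thus ?thesis
  proof (rule summable_on_comparison_test)
    fix n show "mangoldt n * real n powr (-\<sigma>) \<le> ln (real n) * real n powr (-\<sigma>)"
      by (cases "n = 0") (auto intro: mult_right_mono mangoldt_le)
  qed (auto intro: mult_nonneg_nonneg mangoldt_nonneg)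
qed

lemma mangoldt_ser_abs_summable:
  assumes "1 < Re s"
  shows "(\<lambda>n. norm (mangoldt n * of_nat n powr (-s) :: complex)) summable_on UNIV"
  using summable_mangoldt[OF assms] by (simp add: norm_mult norm_of_nat_powr)

lemma zeta_ser_abs_summable:
  assumes "1 < Re s"
  shows "(\<lambda>n. norm (of_nat n powr (-s) :: complex)) summable_on UNIV"
  using summable_zeta[OF assms] by (simp add: norm_of_nat_powr)

text \<open>
  Multiplying the two absolutely convergent series and collecting the terms with \<open>d m = n\<close>
  turns \<open>\<Sum>d | n. \<Lambda>(d) = ln n\<close> into an identity of Dirichlet series.
\<close>
lemma mangoldt_ser_times_zeta_ser:
  assumes "1 < Re s"
  shows "mangoldt_ser s * zeta_ser s = - deriv zeta_ser s"
proof -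
  define a where "a = (\<lambda>n. mangoldt n * of_nat n powr (-s) :: complex)"
  define b where "b = (\<lambda>n. of_nat n powr (-s) :: complex)"
  have a_abs: "(\<lambda>n. norm (a n)) summable_on UNIV"
    unfolding a_def by (rule mangoldt_ser_abs_summable[OF assms])
  have b_abs: "(\<lambda>n. norm (b n)) summable_on UNIV"
    unfolding b_def by (rule zeta_ser_abs_summable[OF assms])
  have a_sum: "(a has_sum mangoldt_ser s) UNIV"
    using abs_summable_summable[OF a_abs] unfolding mangoldt_ser_def a_def by simp
  have b_sum: "(b has_sum zeta_ser s) UNIV"
  proof -
    have "(b has_sum infsum b UNIV) UNIV" using abs_summable_summable[OF b_abs] by simp
    moreover from this have "infsum b UNIV = zeta_ser s"
      using has_sum_imp_sums zeta_ser_sums[OF assms] sums_unique2 unfolding b_def by blast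
    ultimately show ?thesis by simp
  qed
  have "(\<lambda>x. norm (case x of (d, m) \<Rightarrow> a d * b m)) summable_on UNIV \<times> UNIV"
    unfolding Infinite_Sum.abs_summable_on_Sigma_iff
    using a_abs b_abs
    by (auto simp: norm_mult infsum_cmult_right' abs_mult
             intro!: summable_on_cmult_right summable_on_cmult_left)
  hence "(\<lambda>(d, m). a d * b m) summable_on UNIV \<times> UNIV" by (rule abs_summable_summable)
  hence "((\<lambda>(d, m). a d * b m) has_sum (mangoldt_ser s * zeta_ser s)) (UNIV \<times> UNIV)"
    by (intro has_sum_SigmaI[where g = "\<lambda>d. a d * zeta_ser s"])
       (auto intro!: has_sum_cmult_right has_sum_cmult_left a_sum b_sum)
  \<comment> \<open>The index 0 contributes nothing because \<open>0 powr z = 0\<close>; without it, \<open>(d, m) \<mapsto> (d m, d)\<close> is invertible.\<close>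
  also have "?this \<longleftrightarrow> ((\<lambda>(d, m). a d * b m) has_sum (mangoldt_ser s * zeta_ser s)) ({0<..} \<times> {0<..})"
    by (rule has_sum_cong_neutral) (auto simp: a_def b_def)
  also have "\<dots> \<longleftrightarrow> ((\<lambda>(n, d). mangoldt d * of_nat n powr (-s)) has_sum (mangoldt_ser s * zeta_ser s))
      (SIGMA n:{0<..}. {d. d dvd n})"
  proof (rule has_sum_reindex_bij_witness[where j = "\<lambda>(d, m). (d * m, d)" and i = "\<lambda>(n, d). (d, n div d)"])
    fix x :: "nat \<times> nat" assume "x \<in> {0<..} \<times> {0<..}"
    thus "(case (case x of (d, m) \<Rightarrow> (d * m, d)) of (n, d) \<Rightarrow> mangoldt d * of_nat n powr (-s)) =
        (case x of (d, m) \<Rightarrow> a d * b m)"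
      by (auto simp: a_def b_def powr_times_real)
  qed (auto elim!: dvdE intro!: Nat.gr0I)
  finally have "((\<lambda>n. of_real (ln (real n)) * of_nat n powr (-s)) has_sum (mangoldt_ser s * zeta_ser s)) {0<..}"
  proof (rule has_sum_SigmaD)
    fix n :: nat assume n: "n \<in> {0<..}"
    hence "(\<Sum>d | d dvd n. mangoldt d * of_nat n powr (-s)) = of_real (ln (real n)) * of_nat n powr (-s)"
      by (simp add: mangoldt_sum flip: sum_distrib_right)
    with n show "((\<lambda>d. case (n, d) of (n, d) \<Rightarrow> mangoldt d * of_nat n powr (-s)) has_sum
        of_real (ln (real n)) * of_nat n powr (-s)) {d. d dvd n}"
      by (auto intro!: has_sum_finiteI finite_divisors_nat)
  qed
  also have "?this \<longleftrightarrow> ((\<lambda>n. of_real (ln (real n)) * of_nat n powr (-s)) has_sum (mangoldt_ser s * zeta_ser s)) UNIV"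
    by (rule has_sum_cong_neutral) auto
  finally show ?thesis
    using has_sum_imp_sums zeta_ser_has_deriv(1)[OF assms] sums_unique2 by blast
qed

lemma mangoldt_ser_times_zeta_num:
  assumes "1 < Re s"
  shows "mangoldt_ser s * zeta_num s = zeta_num s / (s - 1) - deriv zeta_num s"
proof -
  have "((\<lambda>s. (s - 1) * zeta_ser s) has_field_derivative (s - 1) * deriv zeta_ser s + 1 * zeta_ser s) (at s)"
    by (rule DERIV_mult'[OF _ zeta_ser_has_deriv(2)[OF assms]]) (auto intro!: derivative_eq_intros)
  hence "(zeta_num has_field_derivative (s - 1) * deriv zeta_ser s + 1 * zeta_ser s) (at s)"
    by (rule has_field_derivative_transform_within_open[of _ _ _ "{s. 1 < Re s}"])
       (use assms in \<open>auto simp: open_halfspace_Re_gt zeta_num_eq\<close>)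
  hence d: "deriv zeta_num s = (s - 1) * deriv zeta_ser s + zeta_ser s"
    using DERIV_imp_deriv by fastforce
  have "mangoldt_ser s * zeta_num s = (s - 1) * (mangoldt_ser s * zeta_ser s)"
    by (simp add: zeta_num_eq assms)
  also have "\<dots> = zeta_ser s - deriv zeta_num s"
    by (simp add: d mangoldt_ser_times_zeta_ser assms)
  also have "zeta_ser s = zeta_num s / (s - 1)"
    using assms by (auto simp: zeta_num_eq)
  finally show ?thesis .
qed

text \<open>
  Writing \<open>(s - 1) \<zeta>(s) = (s - w)\<^bsup>m\<^esup> g(s)\<close> near \<open>w = 1 + it\<close> with \<open>g(w) \<noteq> 0\<close> gives
  \<open>F(s) = 1/(s - 1) - m/(s - w) - g'(s)/g(s)\<close>. Multiplication by \<open>\<delta> = s - w\<close> kills the last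
  term in the limit, and also the first one unless \<open>t = 0\<close>.
\<close>
lemma mangoldt_ser_limit:
  fixes t :: real
  obtains m :: nat where "t = 0 \<Longrightarrow> m = 0"
    "((\<lambda>\<delta>. of_real \<delta> * mangoldt_ser (1 + of_real \<delta> + \<i> * of_real t)) \<longlongrightarrow> of_bool (t = 0) - of_nat m) (at_right 0)"
proof -
  define w where "w = 1 + \<i> * of_real t"
  define H where "H = {s::complex. 0 < Re s}"
  define m where "m = nat (zorder zeta_num w)"
  define g where "g = zor_poly zeta_num w"
  have H: "open H" "connected H" "w \<in> H" "\<exists>z\<in>H. zeta_num z \<noteq> 0"
    using zeta_num_1 by (auto simp: H_def w_def open_halfspace_Re_gt intro!: exI[of _ 1]
       convex_connected convex_halfspace_Re_gt)
  from zorder_exist_zero[OF zeta_num_holomorphic[folded H_def] H]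
  obtain r where r: "r > 0" "cball w r \<subseteq> H" "g holomorphic_on cball w r"
      "\<And>z. z \<in> cball w r \<Longrightarrow> zeta_num z = g z * (z - w) ^ m" "\<And>z. z \<in> cball w r \<Longrightarrow> g z \<noteq> 0"
    and ord: "if zeta_num w = 0 then 0 < zorder zeta_num w else zorder zeta_num w = 0"
    unfolding g_def m_def by blast
  have g_hol: "g holomorphic_on ball w r" using r(3) by (rule holomorphic_on_subset) auto
  have "t = 0 \<Longrightarrow> m = 0" using ord zeta_num_1 by (auto simp: m_def w_def)
  moreover have "((\<lambda>\<delta>. of_real \<delta> * mangoldt_ser (1 + of_real \<delta> + \<i> * of_real t)) \<longlongrightarrow> of_bool (t = 0) - of_nat m) (at_right 0)"
  proof -
    have path: "((\<lambda>\<delta>. w + of_real \<delta>) \<longlongrightarrow> w) (at_right 0)"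
      using tendsto_add[OF tendsto_const tendsto_of_real[OF tendsto_ident_at[of "0::real" "{0<..}"]], of w] by simp
    have cont: "isCont g w"
      by (rule continuous_on_interior[OF holomorphic_on_imp_continuous_on[OF g_hol]])
         (use r(1) in simp)
    have cont': "isCont (deriv g) w"
      by (rule continuous_on_interior[OF holomorphic_on_imp_continuous_on[OF
            holomorphic_deriv[OF g_hol open_ball]]])
         (use r(1) in simp)
    have gw: "g w \<noteq> 0" using r by auto
    have 1: "((\<lambda>\<delta>. of_real \<delta> * deriv g (w + of_real \<delta>) / g (w + of_real \<delta>)) \<longlongrightarrow> 0 * deriv g w / g w) (at_right 0)"
    proof (rule tendsto_divide[OF tendsto_mult])
      show "((\<lambda>\<delta>. complex_of_real \<delta>) \<longlongrightarrow> 0) (at_right 0)"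
        using tendsto_of_real[OF tendsto_ident_at[of "0::real" "{0<..}"]] by simp
    qed (rule isCont_tendsto_compose[OF cont path] isCont_tendsto_compose[OF cont' path] gw)+
    have 2: "((\<lambda>\<delta>. of_real \<delta> / (of_real \<delta> + \<i> * of_real t)) \<longlongrightarrow> of_bool (t = 0)) (at_right 0)"
    proof (cases "t = 0")
      case True
      have "eventually (\<lambda>\<delta>. 1 = complex_of_real \<delta> / (of_real \<delta> + \<i> * of_real t)) (at_right 0)"
        using eventually_at_right_less[of "0::real"] by eventually_elim (auto simp: True)
      from Lim_transform_eventually[OF tendsto_const this] show ?thesis using True by simp
    next
      case False
      have "((\<lambda>\<delta>. complex_of_real \<delta> / (of_real \<delta> + \<i> * of_real t)) \<longlongrightarrow> of_real 0 / (of_real 0 + \<i> * of_real t)) (at_right 0)"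
        by (intro tendsto_intros) (use False in auto)
      thus ?thesis using False by simp
    qed
    have "((\<lambda>\<delta>. of_real \<delta> / (of_real \<delta> + \<i> * of_real t) - (of_real \<delta> * deriv g (w + of_real \<delta>) / g (w + of_real \<delta>) + of_nat m))
        \<longlongrightarrow> of_bool (t = 0) - of_nat m) (at_right 0)"
      using tendsto_diff[OF 2 tendsto_add[OF 1 tendsto_const[of "of_nat m"]]] by simp
    moreover have "eventually (\<lambda>\<delta>. of_real \<delta> / (of_real \<delta> + \<i> * of_real t) - (of_real \<delta> * deriv g (w + of_real \<delta>) / g (w + of_real \<delta>) + of_nat m)
        = of_real \<delta> * mangoldt_ser (1 + of_real \<delta> + \<i> * of_real t)) (at_right 0)"
      using eventually_at_right_real[OF r(1)]
    proof eventually_elim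
      case (elim \<delta>)
      define z where "z = w + of_real \<delta>"
      have z: "z \<in> ball w r" "z - w = of_real \<delta>" "1 < Re z" "z \<noteq> w" "z - 1 = of_real \<delta> + \<i> * of_real t"
        using elim by (auto simp: z_def w_def dist_norm)
      have dg: "(g has_field_derivative deriv g z) (at z)"
        using g_hol z(1) holomorphic_derivI by blast
      have "((\<lambda>z. g z * (z - w) ^ m) has_field_derivative
          deriv g z * (z - w) ^ m + g z * (of_nat m * (z - w) ^ (m - 1))) (at z)"
        by (auto intro!: derivative_eq_intros dg)
      hence "(zeta_num has_field_derivative
          deriv g z * (z - w) ^ m + g z * (of_nat m * (z - w) ^ (m - 1))) (at z)"
        by (rule has_field_derivative_transform_within_open[of _ _ _ "ball w r"]) (use z r in auto)
      hence "deriv zeta_num z = deriv g z * (z - w) ^ m + g z * (of_nat m * (z - w) ^ (m - 1))"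
        by (rule DERIV_imp_deriv)
      moreover have "u * (p * u ^ m + q * (of_nat m * u ^ (m - 1))) = u ^ m * (u * p + of_nat m * q)"
        for u p q :: complex
        by (cases m) (simp_all add: algebra_simps)
      ultimately have "(z - w) * deriv zeta_num z =
          (z - w) ^ m * ((z - w) * deriv g z + of_nat m * g z)"
        by simp
      moreover have gz: "g z \<noteq> 0" "zeta_num z = g z * (z - w) ^ m" using r(4,5)[of z] z by auto
      ultimately have *: "(z - w) * deriv zeta_num z / zeta_num z = (z - w) * deriv g z / g z + of_nat m"
        using z by (simp add: field_simps)
      have "zeta_num z \<noteq> 0" using gz z elim by simp
      hence "mangoldt_ser z = 1 / (z - 1) - deriv zeta_num z / zeta_num z"
        using mangoldt_ser_times_zeta_num[OF z(3)] by (simp add: field_simps)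
      hence **: "(z - w) * mangoldt_ser z = (z - w) / (z - 1) - (z - w) * deriv zeta_num z / zeta_num z"
        by (simp only: right_diff_distrib times_divide_eq_right mult_1_right)
      have "w + of_real \<delta> = z" "1 + of_real \<delta> + \<i> * of_real t = z"
        by (simp_all add: z_def w_def)
      with **[unfolded *, unfolded z(2,5)] show ?case by (simp only:)
    qed
    ultimately show ?thesis by (rule Lim_transform_eventually)
  qed
  ultimately show ?thesis by (rule that)
qed

section \<open>Equidistribution of the weighted angles\<close>

definition mangoldt_weight :: "real \<Rightarrow> nat \<Rightarrow> real" where
  "mangoldt_weight \<delta> n = \<delta> * (mangoldt n * real n powr (-(1 + \<delta>)))"

lemma mangoldt_weight_nonneg: "\<delta> > 0 \<Longrightarrow> mangoldt_weight \<delta> n \<ge> 0"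
  by (simp add: mangoldt_weight_def mangoldt_nonneg)

lemma summable_mangoldt_weight: "\<delta> > 0 \<Longrightarrow> summable (mangoldt_weight \<delta>)"
  unfolding mangoldt_weight_def[abs_def]
  by (intro summable_on_imp_summable summable_on_cmult_right summable_mangoldt) auto

lemma mangoldt_weight_cis_sums:
  assumes "\<delta> > 0"
  shows "(\<lambda>n. of_real (mangoldt_weight \<delta> n) * cis (t * ln (real n))) sums
           (of_real \<delta> * mangoldt_ser (1 + of_real \<delta> + \<i> * of_real (-t)))"
proof -
  define s where "s = 1 + of_real \<delta> + \<i> * of_real (-t)"
  have "((\<lambda>n. mangoldt n * of_nat n powr (-s)) has_sum mangoldt_ser s) UNIV"
    using abs_summable_summable[OF mangoldt_ser_abs_summable[of s]] assms
    unfolding mangoldt_ser_def by (simp add: s_def)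
  hence "((\<lambda>n. of_real \<delta> * (mangoldt n * of_nat n powr (-s))) has_sum of_real \<delta> * mangoldt_ser s) UNIV"
    by (rule has_sum_cmult_right)
  also have "(\<lambda>n. of_real \<delta> * (mangoldt n * of_nat n powr (-s))) =
      (\<lambda>n. of_real (mangoldt_weight \<delta> n) * cis (t * ln (real n)))"
  proof
    fix n :: nat
    show "of_real \<delta> * (mangoldt n * of_nat n powr (-s)) = of_real (mangoldt_weight \<delta> n) * cis (t * ln (real n))"
    proof (cases "n = 0")
      case False
      hence "of_nat n powr (-s) = exp (of_real (-(1 + \<delta>) * ln (real n))) * cis (t * ln (real n))"
        by (simp add: powr_def s_def cis_conv_exp algebra_simps flip: exp_add)
      also have "exp (of_real (-(1 + \<delta>) * ln (real n))) = complex_of_real (real n powr (-(1 + \<delta>)))"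
        using False by (simp add: powr_def flip: exp_of_real)
      finally show ?thesis by (simp add: mangoldt_weight_def)
    qed (auto simp: mangoldt_weight_def)
  qed
  finally show ?thesis unfolding s_def by (rule has_sum_imp_sums)
qed

lemma three_four_one:
  fixes x :: real
  shows "0 \<le> 3 + 4 * cos x + cos (2 * x)"
proof -
  have "3 + 4 * cos x + cos (2 * x) = 2 * (1 + cos x)\<^sup>2"
    by (simp only: cos_double_cos) (simp add: power2_eq_square algebra_simps)
  thus ?thesis by simp
qed

text \<open>
  In terms of zeros, this says that the zeta function has none on the line \<open>Re s = 1\<close>. Positivity
  of the weights suffices: a zero at frequency \<open>t\<close> would produce the limit \<open>-m \<le> -1\<close> there
  and a limit at most 0 at frequency \<open>2t\<close>, against the inequality \<open>three_four_one\<close>.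
\<close>
lemma mangoldt_weight_cis_limit:
  "((\<lambda>\<delta>. \<Sum>n. of_real (mangoldt_weight \<delta> n) * cis (t * ln (real n))) \<longlongrightarrow> of_bool (t = 0)) (at_right 0)"
proof -
  define W where "W = (\<lambda>t \<delta>. \<Sum>n. of_real (mangoldt_weight \<delta> n) * cis (t * ln (real n)))"
  have W_sums: "(\<lambda>n. of_real (mangoldt_weight \<delta> n) * cis (t * ln (real n))) sums W t \<delta>" if "\<delta> > 0" for \<delta> t
    using mangoldt_weight_cis_sums[OF that] unfolding W_def by (simp add: sums_iff)
  have "\<exists>m::nat. (t = 0 \<longrightarrow> m = 0) \<and> (W t \<longlongrightarrow> of_bool (t = 0) - of_nat m) (at_right 0)" for t
  proof -
    obtain m :: nat where m: "-t = 0 \<Longrightarrow> m = 0"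
      "((\<lambda>\<delta>. of_real \<delta> * mangoldt_ser (1 + of_real \<delta> + \<i> * of_real (-t))) \<longlongrightarrow> of_bool (-t = 0) - of_nat m) (at_right 0)"
      using mangoldt_ser_limit[of "-t"] by metis
    have "eventually (\<lambda>\<delta>. of_real \<delta> * mangoldt_ser (1 + of_real \<delta> + \<i> * of_real (-t)) = W t \<delta>) (at_right 0)"
      using eventually_at_right_less[of "0::real"]
      by eventually_elim (use W_sums mangoldt_weight_cis_sums sums_unique2 in blast)
    from Lim_transform_eventually[OF m(2) this] m(1) show ?thesis by auto
  qed
  then obtain m :: "real \<Rightarrow> nat" where m0: "m 0 = 0"
    and m: "\<And>t. (W t \<longlongrightarrow> of_bool (t = 0) - of_nat (m t)) (at_right 0)"
    by metis
  have "m t = 0"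
  proof (cases "t = 0")
    case False
    have "eventually (\<lambda>\<delta>. 0 \<le> Re (3 * W 0 \<delta> + 4 * W t \<delta> + W (2 * t) \<delta>)) (at_right 0)"
      using eventually_at_right_less[of "0::real"]
    proof eventually_elim
      case (elim \<delta>)
      have "(\<lambda>n. Re (3 * (of_real (mangoldt_weight \<delta> n) * cis (0 * ln (real n)))
           + 4 * (of_real (mangoldt_weight \<delta> n) * cis (t * ln (real n)))
           + of_real (mangoldt_weight \<delta> n) * cis (2 * t * ln (real n))))
           sums Re (3 * W 0 \<delta> + 4 * W t \<delta> + W (2 * t) \<delta>)"
        by (intro sums_Re sums_add sums_mult W_sums elim)
      moreover have "0 \<le> Re (3 * (of_real (mangoldt_weight \<delta> n) * cis (0 * ln (real n)))
           + 4 * (of_real (mangoldt_weight \<delta> n) * cis (t * ln (real n)))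
           + of_real (mangoldt_weight \<delta> n) * cis (2 * t * ln (real n)))" for n
        using mult_nonneg_nonneg[OF mangoldt_weight_nonneg[OF elim, of n] three_four_one[of "t * ln (real n)"]]
        by (simp add: algebra_simps)
      ultimately show ?case by (metis (mono_tags, lifting) sums_le sums_zero)
    qed
    moreover have "((\<lambda>\<delta>. Re (3 * W 0 \<delta> + 4 * W t \<delta> + W (2 * t) \<delta>)) \<longlongrightarrow>
        Re (3 * (of_bool (0 = (0::real)) - of_nat (m 0)) + 4 * (of_bool (t = 0) - of_nat (m t)) + (of_bool (2 * t = 0) - of_nat (m (2 * t))))) (at_right 0)"
      by (intro tendsto_intros m)
    ultimately have "0 \<le> Re (3 * (of_bool (0 = (0::real)) - of_nat (m 0)) + 4 * (of_bool (t = 0) - of_nat (m t)) + (of_bool (2 * t = 0) - of_nat (m (2 * t))))"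
      by (intro tendsto_lowerbound[of _ _ "at_right 0"]) auto
    hence "0 \<le> 3 - 4 * real (m t) - real (m (2 * t))" using False m0 by simp
    thus ?thesis by linarith
  qed (use m0 in auto)
  with m[of t] show ?thesis by (simp add: W_def)
qed

text \<open>
  Since \<open>(1 + cos x)/2 = (1 + exp(ix))\<^sup>2 exp(-ix) / 4\<close>, the binomial theorem produces the
  Fourier coefficients.
\<close>
lemma raised_cosine_fourier:
  "of_real (((1 + cos x) / 2) ^ N) =
     (\<Sum>k\<le>2*N. of_nat ((2*N) choose k) / 4 ^ N * cis ((real k - real N) * x))"
proof -
  have "of_real ((1 + cos x) / 2) = (cis x + 1)\<^sup>2 * cis (-x) / 4"
  proof -
    have "(cis x + 1)\<^sup>2 * cis (-x) = cis x * (cis x * cis (-x)) + 2 * (cis x * cis (-x)) + cis (-x)"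
      by (simp only: power2_eq_square ring_distribs mult_1_left mult_1_right mult.assoc)
         (simp only: mult_2 ring_distribs add.assoc)
    also have "\<dots> = cis x + 2 + cis (-x)"
      by (simp add: cis_mult)
    finally have "(cis x + 1)\<^sup>2 * cis (-x) = cis x + 2 + cis (-x)" .
    thus ?thesis by (simp add: complex_eq_iff)
  qed
  hence "of_real (((1 + cos x) / 2) ^ N) = ((cis x + 1)\<^sup>2 * cis (-x) / 4) ^ N"
    by (metis of_real_power)
  also have "\<dots> = (cis x + 1) ^ (2 * N) * cis (real N * (-x)) / 4 ^ N"
    by (simp only: power_divide power_mult_distrib power_mult Complex.DeMoivre)
  also have "\<dots> = (\<Sum>k\<le>2*N. of_nat ((2*N) choose k) / 4 ^ N * (cis x ^ k * cis (real N * (-x))))"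
    by (simp add: binomial_ring sum_distrib_left sum_distrib_right sum_divide_distrib mult_ac)
  also have "\<dots> = (\<Sum>k\<le>2*N. of_nat ((2*N) choose k) / 4 ^ N * cis ((real k - real N) * x))"
    by (simp add: Complex.DeMoivre cis_mult algebra_simps)
  finally show ?thesis .
qed

text \<open>
  Only the frequency 0, that is \<open>k = N\<close> in \<open>raised_cosine_fourier\<close>, survives in the limit;
  for \<open>N = 0\<close> the statement says that the total weight tends to 1.
\<close>
lemma mangoldt_weight_raised_cosine_limit:
  assumes "y \<noteq> 0"
  shows "((\<lambda>\<delta>. \<Sum>n. mangoldt_weight \<delta> n * ((1 + cos (y * ln (real n) + \<alpha>)) / 2) ^ N)
           \<longlongrightarrow> real ((2*N) choose N) / 4 ^ N) (at_right 0)"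
proof -
  define c where "c = (\<lambda>k. of_nat ((2*N) choose k) / 4 ^ N * cis ((real k - real N) * \<alpha>))"
  define f where "f = (\<lambda>n. ((1 + cos (y * ln (real n) + \<alpha>)) / 2) ^ N)"
  define W where "W = (\<lambda>t \<delta>. \<Sum>n. of_real (mangoldt_weight \<delta> n) * cis (t * ln (real n)))"
  have f: "complex_of_real (f n) = (\<Sum>k\<le>2*N. c k * cis ((real k - real N) * y * ln (real n)))" for n
    unfolding f_def raised_cosine_fourier c_def
    by (intro sum.cong refl) (simp add: mult.assoc cis_mult algebra_simps)
  have sums: "(\<lambda>n. mangoldt_weight \<delta> n * f n) sums Re (\<Sum>k\<le>2*N. c k * W ((real k - real N) * y) \<delta>)"
    if "\<delta> > 0" for \<delta>
  proof -
    have "(\<lambda>n. \<Sum>k\<le>2*N. c k * (of_real (mangoldt_weight \<delta> n) * cis ((real k - real N) * y * ln (real n))))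
        sums (\<Sum>k\<le>2*N. c k * W ((real k - real N) * y) \<delta>)"
      unfolding W_def using mangoldt_weight_cis_sums[OF that]
      by (intro sums_sum sums_mult) (auto simp: sums_iff)
    also have "(\<lambda>n. \<Sum>k\<le>2*N. c k * (of_real (mangoldt_weight \<delta> n) * cis ((real k - real N) * y * ln (real n))))
        = (\<lambda>n. complex_of_real (mangoldt_weight \<delta> n * f n))"
      by (simp add: f sum_distrib_left mult_ac)
    finally show ?thesis using sums_Re by fastforce
  qed
  have "((\<lambda>\<delta>. Re (\<Sum>k\<le>2*N. c k * W ((real k - real N) * y) \<delta>)) \<longlongrightarrow>
      Re (\<Sum>k\<le>2*N. c k * of_bool ((real k - real N) * y = 0))) (at_right 0)"
    unfolding W_def by (intro tendsto_intros mangoldt_weight_cis_limit)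
  also have "(\<Sum>k\<le>2*N. c k * of_bool ((real k - real N) * y = 0)) = (\<Sum>k\<in>{N}. c k)"
    using assms by (intro sum.mono_neutral_cong_right) auto
  also have "Re (\<Sum>k\<in>{N}. c k) = real ((2*N) choose N) / 4 ^ N"
  proof -
    have "c N = of_real (real ((2*N) choose N) / 4 ^ N)" by (simp add: c_def)
    thus ?thesis by (simp only: sum.insert sum.empty finite.emptyI empty_iff not_False_eq_True
          add_0_right Re_complex_of_real)
  qed
  finally show ?thesis
  proof (rule Lim_transform_eventually)
    show "eventually (\<lambda>\<delta>. Re (\<Sum>k\<le>2*N. c k * W ((real k - real N) * y) \<delta>) =
       (\<Sum>n. mangoldt_weight \<delta> n * ((1 + cos (y * ln (real n) + \<alpha>)) / 2) ^ N)) (at_right 0)"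
      using eventually_at_right_less[of "0::real"]
      by eventually_elim (use sums in \<open>auto simp: sums_iff f_def\<close>)
  qed
qed

section \<open>Sets of vanishing weight\<close>

text \<open>
  Only the proper prime powers \<open>p\<^bsup>j+2\<^esup>\<close> matter, and \<open>ln p / p\<^bsup>j+2\<^esup> \<le> (ln p / p\<^sup>2) 2\<^bsup>-j\<^esup>\<close>. The sum of
  \<open>ln p / p\<^sup>2\<close> is part of the von Mangoldt series at \<open>s = 2\<close>.
\<close>
lemma summable_on_mangoldt_nonprime:
  "(\<lambda>n. mangoldt n / real n) summable_on {n. \<not> prime n}"
proof -
  define P where "P = {p::nat. prime p}"
  define h where "h = (\<lambda>(p::nat, j::nat). p ^ (j + 2))"
  have inj: "inj_on h (P \<times> UNIV)"
  proof (rule inj_onI, safe)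
    fix p j q i assume "p \<in> P" "q \<in> P" and eq: "h (p, j) = h (q, i)"
    hence pq: "prime p" "prime q" by (simp_all add: P_def)
    from eq have pow: "p ^ (j + 2) = q ^ (i + 2)" by (simp only: h_def prod.case)
    show "p = q" by (rule prime_power_inj'(1)[OF pq pow]) simp_all
    have "j + 2 = i + 2" by (rule prime_power_inj'(2)[OF pq pow]) simp_all
    thus "j = i" by simp
  qed
  have "(\<lambda>(p, j). mangoldt p * real p powr (-2) * (1/2) ^ j) summable_on (P \<times> UNIV)"
  proof (rule summable_on_SigmaI)
    fix p assume "p \<in> P"
    have "((\<lambda>j. (1/2) ^ j) has_sum (2::real)) UNIV"
      by (rule norm_summable_imp_has_sum) (use geometric_sums[of "1/2::real"] in auto)
    from has_sum_cmult_right[OF this, of "mangoldt p * real p powr (-2)"]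
    show "((\<lambda>j. case (p, j) of (p, j) \<Rightarrow> mangoldt p * real p powr (-2) * (1/2) ^ j) has_sum mangoldt p * real p powr (-2) * 2) UNIV"
      by simp
  next
    show "(\<lambda>p. mangoldt p * real p powr (-2) * 2) summable_on P"
      by (intro summable_on_cmult_left summable_on_subset[OF summable_mangoldt]) auto
  qed (auto simp: mangoldt_nonneg)
  hence "((\<lambda>n. mangoldt n / real n) \<circ> h) summable_on (P \<times> UNIV)"
  proof (rule summable_on_comparison_test, safe)
    fix p j :: nat assume "p \<in> P"
    hence p: "prime p" by (simp add: P_def)
    hence p2: "2 \<le> real p" using prime_ge_2_nat by simp
    have "1 / real p ^ (j + 2) = real p powr (-2) * (1 / real p) ^ j"
      using p2 by (simp add: power_add powr_minus powr_numeral power2_eq_square field_simps)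
    also have "\<dots> \<le> real p powr (-2) * (1/2) ^ j"
      using p2 by (intro mult_left_mono power_mono) (auto simp: field_simps)
    finally have "ln (real p) * (1 / real p ^ (j + 2)) \<le> ln (real p) * (real p powr (-2) * (1/2) ^ j)"
      using p2 by (intro mult_left_mono) auto
    moreover have "mangoldt (p ^ (j + 2)) = ln (real p)"
      using p by (subst mangoldt_primepow') auto
    ultimately show "((\<lambda>n. mangoldt n / real n) \<circ> h) (p, j) \<le> mangoldt p * real p powr (-2) * (1/2) ^ j"
      using p by (simp add: h_def mult.assoc del: power_Suc power_add add_2_eq_Suc')
  qed (auto simp: mangoldt_nonneg)
  hence "(\<lambda>n. mangoldt n / real n) summable_on h ` (P \<times> UNIV)"
    by (subst summable_on_reindex[OF inj])
  also have "?this \<longleftrightarrow> (\<lambda>n. mangoldt n / real n) summable_on {n. \<not> prime n}"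
  proof (rule summable_on_cong_neutral)
    fix n assume n: "n \<in> {n. \<not> prime n} - h ` (P \<times> UNIV)"
    have "\<not> primepow n"
    proof
      assume "primepow n"
      then obtain p k where pk: "prime p" "k > 0" "n = p ^ k" by (auto simp: primepow_def)
      with n have "k \<noteq> 1" by auto
      with pk have "k - 2 + 2 = k" by linarith
      with pk have "n = h (p, k - 2)" by (simp only: h_def prod.case)
      moreover have "(p, k - 2) \<in> P \<times> UNIV" using pk by (simp add: P_def)
      ultimately have "n \<in> h ` (P \<times> UNIV)" by (rule image_eqI)
      with n show False by blast
    qed
    thus "mangoldt n / real n = 0" by (simp add: mangoldt_def)
  next
    fix n assume n: "n \<in> h ` (P \<times> UNIV) - {n. \<not> prime n}"
    then obtain p j where "n = p ^ (j + 2)" "prime n" by (auto simp only: h_def prod.case)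
    hence False by (simp add: prime_power_iff del: power_Suc power_add add_2_eq_Suc')
    thus "mangoldt n / real n = 0" ..
  qed auto
  finally show ?thesis .
qed

text \<open>
  Each single weight tends to 0, and for \<open>0 < \<delta> < 1\<close> the weights have a summable bound that is
  independent of \<open>\<delta>\<close>, namely \<open>1/n\<close> on \<open>A\<close> and \<open>\<Lambda>(n)/n\<close> off the primes; so the limit may be
  taken termwise.
\<close>
lemma mangoldt_weight_sparse_limit:
  assumes A: "A \<subseteq> {p. prime p}" and sm: "(\<lambda>p. 1 / real p) summable_on A"
  shows "((\<lambda>\<delta>. \<Sum>n. mangoldt_weight \<delta> n * of_bool (n \<in> A \<or> \<not> prime n)) \<longlongrightarrow> 0) (at_right 0)"
proof -
  define M where "M = (\<lambda>n. if n \<in> A then 1 / real n else if prime n then 0 else mangoldt n / real n)"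
  have "(M has_sum infsum (\<lambda>p. 1 / real p) A) A"
    using sm by (subst has_sum_cong[of _ _ "\<lambda>p. 1 / real p"]) (auto simp: M_def)
  hence 1: "M summable_on A" by (auto simp: summable_on_def)
  have 2: "M summable_on {n. \<not> prime n}"
    using summable_on_mangoldt_nonprime
    by (rule summable_on_cong[THEN iffD1, rotated]) (use A in \<open>auto simp: M_def\<close>)
  have "M summable_on (A \<union> {n. \<not> prime n})"
    using A by (intro summable_on_Un_disjoint 1 2) auto
  also have "?this \<longleftrightarrow> M summable_on UNIV"
    by (rule summable_on_cong_neutral) (auto simp: M_def)
  finally have M: "summable M" by (rule summable_on_imp_summable)
  have bd: "norm (mangoldt_weight \<delta> n * of_bool (n \<in> A \<or> \<not> prime n)) \<le> M n"
    if \<delta>: "\<delta> \<in> {0<..<1}" for \<delta> n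
  proof (cases "n = 0")
    case False
    have w: "mangoldt_weight \<delta> n = mangoldt n / real n * (\<delta> * real n powr (-\<delta>))"
      using False by (simp add: mangoldt_weight_def powr_diff powr_minus field_simps powr_add)
    have le1: "real n powr (-\<delta>) \<le> 1"
      using False \<delta> powr_mono[of "-\<delta>" 0 "real n"] by auto
    have "\<delta> * ln (real n) \<le> real n powr \<delta>"
      using False exp_ge_add_one_self[of "\<delta> * ln (real n)"]
      by (simp add: powr_def del: exp_ge_add_one_self)
    hence le2: "\<delta> * ln (real n) * real n powr (-\<delta>) \<le> 1"
      using False by (simp add: powr_minus field_simps)
    have "mangoldt_weight \<delta> n \<le> 1 / real n" if "n \<in> A"
    proof -
      have "mangoldt n = ln (real n)" using that A by auto
      hence "mangoldt_weight \<delta> n = (\<delta> * ln (real n) * real n powr (-\<delta>)) / real n" by (simp add: w)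
      also have "\<dots> \<le> 1 / real n" using le2 by (intro divide_right_mono) auto
      finally show ?thesis .
    qed
    moreover have "mangoldt_weight \<delta> n \<le> mangoldt n / real n"
    proof -
      have "\<delta> * real n powr (-\<delta>) \<le> 1 * 1" using le1 \<delta> by (intro mult_mono) auto
      thus ?thesis unfolding w by (intro mult_left_le) (auto simp: mangoldt_nonneg)
    qed
    ultimately show ?thesis using \<delta> by (auto simp: M_def mangoldt_weight_nonneg)
  qed (auto simp: mangoldt_weight_def M_def)
  have "eventually (\<lambda>(n, \<delta>). norm (mangoldt_weight \<delta> n * of_bool (n \<in> A \<or> \<not> prime n)) \<le> M n) (at_top \<times>\<^sub>F at_right 0)"
    unfolding eventually_prod_filter
  proof (intro exI conjI allI impI)
    show "eventually (\<lambda>\<delta>. \<delta> \<in> {0<..<1::real}) (at_right 0)" by (rule eventually_at_right_real) auto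
    show "eventually (\<lambda>n::nat. True) at_top" by simp
  qed (use bd in auto)
  moreover have "((\<lambda>\<delta>. mangoldt_weight \<delta> n * of_bool (n \<in> A \<or> \<not> prime n)) \<longlongrightarrow> 0) (at_right 0)" for n
  proof (cases "n = 0")
    case False
    have "((\<lambda>\<delta>. \<delta> * (mangoldt n * real n powr (-(1 + \<delta>)))) \<longlongrightarrow> 0 * (mangoldt n * real n powr (-(1 + 0)))) (at_right 0)"
      using False by (intro tendsto_intros) auto
    thus ?thesis unfolding mangoldt_weight_def by (auto intro!: tendsto_mult_left_zero)
  qed (auto simp: mangoldt_weight_def)
  ultimately show ?thesis
    using tannerys_theorem[of "\<lambda>n \<delta>. mangoldt_weight \<delta> n * of_bool (n \<in> A \<or> \<not> prime n)" "\<lambda>_. 0" "at_right 0" M] M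
    by simp
qed

section \<open>Primes with angles in an arc\<close>

text \<open>
  The central binomial coefficient over \<open>4\<^bsup>N\<^esup>\<close> decays no faster than \<open>1/(2N)\<close>, hence more slowly
  than any geometric sequence.
\<close>
lemma exists_large_central_binomial:
  fixes c :: real
  assumes "0 < c" "c < 1"
  obtains N :: nat where "c ^ N < real ((2*N) choose N) / 4 ^ N"
proof -
  have "((\<lambda>N. real N * c ^ N) \<longlongrightarrow> 0) sequentially"
    using powser_times_n_limit_0[of c] assms by simp
  hence "eventually (\<lambda>N. real N * c ^ N < 1 / 2) sequentially"
    by (rule order_tendstoD) auto
  with eventually_gt_at_top[of 0] have "eventually (\<lambda>N. N > 0 \<and> real N * c ^ N < 1 / 2) sequentially"
    by eventually_elim auto
  then obtain N where N: "N > 0" "real N * c ^ N < 1 / 2"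
    using eventually_happens sequentially_bot by blast
  have "c ^ N < 1 / (2 * real N)" using N by (simp add: field_simps)
  also have "\<dots> = 4 ^ N / (2 * real N) / 4 ^ N" by simp
  also have "\<dots> \<le> real ((2*N) choose N) / 4 ^ N"
    using central_binomial_lower_bound[OF N(1)] by (intro divide_right_mono) auto
  finally show ?thesis by (rule that)
qed

text \<open>
  The test function \<open>f\<^bsup>N\<^esup> - c\<^bsup>N\<^esup>\<close> below is bounded by the indicator \<open>g\<close> of the primes in the arc
  together with all nonprimes. If the reciprocals of these primes were summable, the
  weighted sum of \<open>g\<close> would tend to 0, whereas that of the test function tends to a positive number.
\<close>
lemma not_summable_prime_reciprocals_in_arc:
  assumes "y \<noteq> 0" "0 < K" "K < 1"
  shows "\<not> (\<lambda>p. 1 / real p) summable_on {p. prime p \<and> K < cos (y * ln (real p) + \<alpha>)}"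
proof
  define A where "A = {p. prime p \<and> K < cos (y * ln (real p) + \<alpha>)}"
  define c where "c = (1 + K) / 2"
  define f where "f = (\<lambda>n. (1 + cos (y * ln (real n) + \<alpha>)) / 2)"
  assume "(\<lambda>p. 1 / real p) summable_on {p. prime p \<and> K < cos (y * ln (real p) + \<alpha>)}"
  hence A: "(\<lambda>p. 1 / real p) summable_on A" by (simp add: A_def)
  have f: "0 \<le> f n" "f n \<le> 1" for n
    unfolding f_def
    using cos_ge_minus_one[of "y * ln (real n) + \<alpha>"] cos_le_one[of "y * ln (real n) + \<alpha>"]
    by (simp_all del: cos_ge_minus_one cos_le_one)
  obtain N where N: "c ^ N < real ((2*N) choose N) / 4 ^ N"
    using exists_large_central_binomial[of c] assms by (auto simp: c_def)
  define g where "g = (\<lambda>n. of_bool (n \<in> A \<or> \<not> prime n) :: real)"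
  have le: "f n ^ N - c ^ N \<le> g n" for n
  proof (cases "n \<in> A \<or> \<not> prime n")
    case True
    have "f n ^ N \<le> 1" using f by (intro power_le_one)
    moreover have "0 \<le> c ^ N" using assms by (simp add: c_def)
    moreover have "g n = 1" using True by (auto simp: g_def)
    ultimately show ?thesis by linarith
  next
    case False
    hence "f n \<le> c" by (auto simp: A_def f_def c_def)
    hence "f n ^ N \<le> c ^ N" using f by (intro power_mono)
    thus ?thesis by (simp add: g_def)
  qed
  \<comment> \<open>The factor \<open>f n ^ 0\<close> makes the total weight an instance of the same limit theorem.\<close>
  have "((\<lambda>\<delta>. (\<Sum>n. mangoldt_weight \<delta> n * f n ^ N) - (\<Sum>n. mangoldt_weight \<delta> n * f n ^ 0) * c ^ N)
      \<longlongrightarrow> real ((2*N) choose N) / 4 ^ N - real ((2*0) choose 0) / 4 ^ 0 * c ^ N) (at_right 0)"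
    unfolding f_def by (intro tendsto_intros mangoldt_weight_raised_cosine_limit assms)
  moreover have "((\<lambda>\<delta>. \<Sum>n. mangoldt_weight \<delta> n * g n) \<longlongrightarrow> 0) (at_right 0)"
    unfolding g_def by (rule mangoldt_weight_sparse_limit) (use A in \<open>auto simp: A_def\<close>)
  moreover have "eventually (\<lambda>\<delta>. (\<Sum>n. mangoldt_weight \<delta> n * f n ^ N) - (\<Sum>n. mangoldt_weight \<delta> n * f n ^ 0) * c ^ N
     \<le> (\<Sum>n. mangoldt_weight \<delta> n * g n)) (at_right 0)"
    using eventually_at_right_less[of "0::real"]
  proof eventually_elim
    case (elim \<delta>)
    have sm: "summable (\<lambda>n. mangoldt_weight \<delta> n * h n)" if "\<And>n. 0 \<le> h n \<and> h n \<le> 1" for h :: "nat \<Rightarrow> real"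
      using that mangoldt_weight_nonneg[OF elim]
      by (intro summable_comparison_test'[OF summable_mangoldt_weight[OF elim]])
         (auto simp: abs_mult intro: mult_left_le)
    have s: "summable (\<lambda>n. mangoldt_weight \<delta> n * f n ^ k)" for k
      by (rule sm) (use f in \<open>auto intro: power_le_one\<close>)
    have "(\<Sum>n. mangoldt_weight \<delta> n * f n ^ N) - (\<Sum>n. mangoldt_weight \<delta> n * f n ^ 0) * c ^ N
       = (\<Sum>n. mangoldt_weight \<delta> n * f n ^ N - mangoldt_weight \<delta> n * f n ^ 0 * c ^ N)"
      by (simp only: suminf_mult2[OF s] suminf_diff[OF s summable_mult2[OF s]])
    also have "\<dots> \<le> (\<Sum>n. mangoldt_weight \<delta> n * g n)"
    proof (intro suminf_le summable_diff s summable_mult2)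
      show "summable (\<lambda>n. mangoldt_weight \<delta> n * g n)" by (rule sm) (auto simp: g_def)
      show "mangoldt_weight \<delta> n * f n ^ N - mangoldt_weight \<delta> n * f n ^ 0 * c ^ N \<le> mangoldt_weight \<delta> n * g n" for n
        using mult_left_mono[OF le mangoldt_weight_nonneg[OF elim]] by (simp add: algebra_simps)
    qed
    finally show ?case .
  qed
  ultimately have "real ((2*N) choose N) / 4 ^ N - real ((2*0) choose 0) / 4 ^ 0 * c ^ N \<le> 0"
    by (intro tendsto_le[of "at_right (0::real)"]) auto
  with N show False by simp
qed

theorem theorem1p2:
  fixes y \<alpha> K :: real
  assumes "y > 0" and "0 \<le> \<alpha>" and "\<alpha> < 2 * pi" and "0 < K" and "K < 1"
  shows "\<not> (\<lambda>p. 1 / real p) summable_on P_plus y \<alpha> K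
       \<and> \<not> (\<lambda>p. 1 / real p) summable_on P_minus y \<alpha> K"
proof
  show "\<not> (\<lambda>p. 1 / real p) summable_on P_plus y \<alpha> K"
    unfolding P_plus_def by (rule not_summable_prime_reciprocals_in_arc) (use assms in auto)
  have "P_minus y \<alpha> K = {p. prime p \<and> K < cos (y * ln (real p) + (\<alpha> + pi))}"
    by (auto simp: P_minus_def simp flip: add.assoc)
  thus "\<not> (\<lambda>p. 1 / real p) summable_on P_minus y \<alpha> K"
    using not_summable_prime_reciprocals_in_arc[of y K "\<alpha> + pi"] assms by simp
qed

end
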